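(* Let $n\geq 1$ and let $\theta$ be a reflexive and transitive binary relation on $\{1,2,\ldots,n\}$. If $R$ is a left Noetherian ring and $A\in M_{n}(\theta,R)$ is invertible in $M_{n}(R)$, then $A^{-1}\in M_{n}(\theta,R)$.
   Context: All rings are associative with identity (not necessarily commutative). $M_n(R)$ is the ring of $n\times n$ matrices over $R$. For a reflexive and transitive relation $\theta$ on $\{1,\ldots,n\}$, the structural matrix ring is the subring $M_{n}(\theta,R)=\{[a_{i,j}]\in M_{n}(R)\mid a_{i,j}=0\text{ if }(i,j)\notin\theta\}$ of $M_n(R)$. *)

theory Defs
  imports "Jordan_Normal_Form.Matrix"
begin

text \<open>
  The coefficient ring is a type of sort \<open>{ring, monoid_mult}\<close>: an associative ring with identity,
  not necessarily commutative. The class \<open>ring_1\<close> is avoided because it demands \<open>0 \<noteq> 1\<close>,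
  which would exclude the zero ring.
\<close>

definition left_ideal :: "'a :: {ring, monoid_mult} set \<Rightarrow> bool" where
  "left_ideal I \<longleftrightarrow>
     0 \<in> I \<and> (\<forall>x\<in>I. \<forall>y\<in>I. x - y \<in> I) \<and> (\<forall>r. \<forall>x\<in>I. r * x \<in> I)"

definition left_noetherian :: "'a :: {ring, monoid_mult} itself \<Rightarrow> bool" where
  "left_noetherian ty \<longleftrightarrow>
     (\<forall>I :: nat \<Rightarrow> 'a set.
        (\<forall>k. left_ideal (I k)) \<and> (\<forall>k. I k \<subseteq> I (Suc k)) \<longrightarrow> (\<exists>N. \<forall>k\<ge>N. I k = I N))"

text \<open>The same record as \<^const>\<open>ring_mat\<close>, whose sort \<open>semiring_1\<close> would exclude the zero ring.\<close>

definition matrix_ring :: "'a :: {ring, monoid_mult} itself \<Rightarrow> nat \<Rightarrow> 'a mat ring" where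
  "matrix_ring ty n =
     \<lparr>carrier = carrier_mat n n, mult = (*), one = 1\<^sub>m n, zero = 0\<^sub>m n n, add = (+)\<rparr>"

text \<open>Matrix entries are indexed from \<open>0\<close>, whereas \<open>\<theta>\<close> is a relation on \<open>{1..n}\<close>.\<close>

definition structural_matrices :: "nat \<Rightarrow> (nat \<times> nat) set \<Rightarrow> 'a :: {ring, monoid_mult} mat set" where
  "structural_matrices n \<theta> =
     {A \<in> carrier_mat n n. \<forall>i\<in>{1..n}. \<forall>j\<in>{1..n}. (i, j) \<notin> \<theta> \<longrightarrow> A $$ (i - 1, j - 1) = 0}"

end

theory Submission
  imports Defs
begin

text \<open>
  Write \<open>S\<close> for the set of structural matrices and \<open>B\<close> for the inverse of \<open>A\<close>. Transitivity of
  \<open>\<theta>\<close> gives \<open>S A \<subseteq> S\<close>, hence \<open>S \<subseteq> S B\<close>, and multiplying by powers of \<open>B\<close> gives the chain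
  \<open>S \<subseteq> S B \<subseteq> S B\<^sup>2 \<subseteq> \<dots>\<close>. Its members are left \<open>R\<close>-submodules of the module of all \<open>n \<times> n\<close>
  matrices, which is free of finite rank and hence Noetherian (\<open>noetherian_mat\<close>), so
  \<open>S B\<^sup>N\<^sup>+\<^sup>1 = S B\<^sup>N\<close> for some \<open>N\<close>. Right multiplication by \<open>B\<close> is injective, and cancelling \<open>B\<^sup>N\<close>
  leaves \<open>S B = S\<close> (\<open>inj_expanding_imp_stable\<close>). Reflexivity puts the identity matrix in \<open>S\<close>, so
  \<open>B = 1 B\<close> lies in \<open>S B = S\<close>.
\<close>

definition mat_submodule :: "nat \<Rightarrow> nat \<Rightarrow> 'a :: {ring, monoid_mult} mat set \<Rightarrow> bool" where
  "mat_submodule nr nc M \<longleftrightarrow> M \<subseteq> carrier_mat nr nc \<and> 0\<^sub>m nr nc \<in> M \<and>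
     (\<forall>X\<in>M. \<forall>Y\<in>M. X - Y \<in> M) \<and> (\<forall>r. \<forall>X\<in>M. r \<cdot>\<^sub>m X \<in> M)"

lemma left_ideal_entries:
  assumes M: "mat_submodule nr nc M" and ij: "i < nr" "j < nc"
  shows "left_ideal ((\<lambda>X. X $$ (i, j)) ` M)"
proof -
  have c: "X \<in> carrier_mat nr nc" if "X \<in> M" for X
    using M that unfolding mat_submodule_def by blast
  have 0: "0 \<in> (\<lambda>X. X $$ (i, j)) ` M"
    using M ij by (intro image_eqI[of _ _ "0\<^sub>m nr nc"]) (auto simp: mat_submodule_def)
  have d: "X $$ (i, j) - Y $$ (i, j) \<in> (\<lambda>X. X $$ (i, j)) ` M" if "X \<in> M" "Y \<in> M" for X Y
    using M ij that c[OF that(1)] c[OF that(2)]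
    by (intro image_eqI[of _ _ "X - Y"]) (auto simp: mat_submodule_def)
  have s: "r * X $$ (i, j) \<in> (\<lambda>X. X $$ (i, j)) ` M" if "X \<in> M" for r X
    using M ij that c[OF that]
    by (intro image_eqI[of _ _ "r \<cdot>\<^sub>m X"]) (auto simp: mat_submodule_def)
  show ?thesis unfolding left_ideal_def using 0 d s by blast
qed

lemma mat_submodule_vanishing_entry:
  assumes M: "mat_submodule nr nc M" and ij: "i < nr" "j < nc"
  shows "mat_submodule nr nc {X \<in> M. X $$ (i, j) = 0}"
proof -
  have c: "X \<in> carrier_mat nr nc" if "X \<in> M" for X
    using M that unfolding mat_submodule_def by blast
  have "X - Y \<in> {X \<in> M. X $$ (i, j) = 0}"
    if "X \<in> {X \<in> M. X $$ (i, j) = 0}" "Y \<in> {X \<in> M. X $$ (i, j) = 0}" for X Y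
    using M that c[of X] c[of Y] ij by (simp add: mat_submodule_def)
  moreover have "r \<cdot>\<^sub>m X \<in> {X \<in> M. X $$ (i, j) = 0}" if "X \<in> {X \<in> M. X $$ (i, j) = 0}" for r X
    using M that c[of X] ij by (simp add: mat_submodule_def)
  moreover have "0\<^sub>m nr nc \<in> {X \<in> M. X $$ (i, j) = 0}"
    using M ij by (simp add: mat_submodule_def)
  ultimately show ?thesis using c unfolding mat_submodule_def by blast
qed

text \<open>
  The usual proof that an extension of Noetherian modules is Noetherian, one matrix position at a
  time: a submodule \<open>M\<close> is determined, among the submodules containing it, by the left ideal of its
  entries at one position together with the submodule of its members that vanish there. The set
  \<open>F\<close> collects the positions at which nonzero entries remain possible.
\<close>

lemma noetherian_mat_supported:
  fixes M :: "nat \<Rightarrow> 'a :: {ring, monoid_mult} mat set"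
  assumes noeth: "left_noetherian TYPE('a)"
    and "finite F" "F \<subseteq> {..<nr} \<times> {..<nc}"
    and "\<And>k. mat_submodule nr nc (M k)" "\<And>k. M k \<subseteq> M (Suc k)"
    and "\<And>k X p. X \<in> M k \<Longrightarrow> p \<in> {..<nr} \<times> {..<nc} - F \<Longrightarrow> X $$ p = 0"
  shows "\<exists>N. \<forall>k\<ge>N. M k = M N"
  using assms(2-)
proof (induction F arbitrary: M rule: finite_induct)
  case empty
  have "M k = {0\<^sub>m nr nc}" for k
  proof -
    have "X = 0\<^sub>m nr nc" if "X \<in> M k" for X
      using that empty(2)[of k] empty(4)[OF that] unfolding mat_submodule_def by (intro eq_matI) auto
    moreover have "0\<^sub>m nr nc \<in> M k" using empty(2)[of k] unfolding mat_submodule_def by blast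
    ultimately show ?thesis by blast
  qed
  then show ?case by blast
next
  case (insert p F)
  obtain i j where p: "p = (i, j)" by (cases p)
  have ij: "i < nr" "j < nc" using insert.prems(1) p by auto
  have mono: "M k \<subseteq> M l" if "k \<le> l" for k l
    using lift_Suc_mono_le[of M, OF insert.prems(3) that] .
  have car: "X \<in> carrier_mat nr nc" if "X \<in> M k" for X k
    using insert.prems(2)[of k] that unfolding mat_submodule_def by blast
  define C where "C k = (\<lambda>X. X $$ (i, j)) ` M k" for k
  define K where "K k = {X \<in> M k. X $$ (i, j) = 0}" for k
  have "\<forall>k. left_ideal (C k)"
    unfolding C_def using left_ideal_entries[OF insert.prems(2) ij] by blast
  moreover have "\<forall>k. C k \<subseteq> C (Suc k)"
    unfolding C_def using insert.prems(3) by blast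
  ultimately obtain N1 where N1: "\<And>k. k \<ge> N1 \<Longrightarrow> C k = C N1"
    using noeth unfolding left_noetherian_def by blast
  have "\<exists>N. \<forall>k\<ge>N. K k = K N"
  proof (rule insert.IH)
    show "F \<subseteq> {..<nr} \<times> {..<nc}" using insert.prems(1) by blast
    show "mat_submodule nr nc (K k)" for k
      unfolding K_def by (rule mat_submodule_vanishing_entry[OF insert.prems(2) ij])
    show "K k \<subseteq> K (Suc k)" for k unfolding K_def using insert.prems(3) by blast
    show "X $$ q = 0" if "X \<in> K k" "q \<in> {..<nr} \<times> {..<nc} - F" for k X q
      using that insert.prems(4)[of X k q] p unfolding K_def by blast
  qed
  then obtain N2 where N2: "\<And>k. k \<ge> N2 \<Longrightarrow> K k = K N2" by blast
  define N where "N = max N1 N2"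
  have "M k \<subseteq> M N" if k: "k \<ge> N" for k
  proof
    fix X assume X: "X \<in> M k"
    have "C k = C N" using N1[of k] N1[of N] k unfolding N_def by simp
    then obtain Y where Y: "Y \<in> M N" "Y $$ (i, j) = X $$ (i, j)"
      using X unfolding C_def by (metis (mono_tags, lifting) imageE imageI)
    have c: "X \<in> carrier_mat nr nc" "Y \<in> carrier_mat nr nc" using car X Y by auto
    have "X - Y \<in> M k"
      using insert.prems(2)[of k] X Y(1) mono[OF k] unfolding mat_submodule_def by blast
    then have "X - Y \<in> K k" using c Y(2) ij unfolding K_def by simp
    then have "X - Y \<in> M N" using N2[of k] N2[of N] k unfolding N_def K_def by auto
    moreover have "0\<^sub>m nr nc - Y \<in> M N"
      using insert.prems(2)[of N] Y(1) unfolding mat_submodule_def by blast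
    \<comment> \<open>The sum of \<open>X - Y\<close> and \<open>Y\<close>, expressed through differences.\<close>
    ultimately have "(X - Y) - (0\<^sub>m nr nc - Y) \<in> M N"
      using insert.prems(2)[of N] unfolding mat_submodule_def by blast
    moreover have "(X - Y) - (0\<^sub>m nr nc - Y) = X" using c by (intro eq_matI) auto
    ultimately show "X \<in> M N" by simp
  qed
  then show ?case using mono by blast
qed

lemma noetherian_mat:
  fixes M :: "nat \<Rightarrow> 'a :: {ring, monoid_mult} mat set"
  assumes "left_noetherian TYPE('a)"
    and "\<And>k. mat_submodule nr nc (M k)" "\<And>k. M k \<subseteq> M (Suc k)"
  shows "\<exists>N. \<forall>k\<ge>N. M k = M N"
  by (rule noetherian_mat_supported[where nr = nr and nc = nc and F = "{..<nr} \<times> {..<nc}"]) (use assms in simp_all)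

text \<open>
  The chain \<open>V \<subseteq> f V \<subseteq> f (f V) \<subseteq> \<dots>\<close> becomes stationary, and injectivity of \<open>f\<close> lets
  stationarity descend to its first step.
\<close>

lemma inj_expanding_imp_stable:
  fixes V :: "'a :: {ring, monoid_mult} mat set"
  assumes noeth: "left_noetherian TYPE('a)"
    and V: "mat_submodule nr nc V"
    and f: "\<And>M. mat_submodule nr nc M \<Longrightarrow> mat_submodule nr nc (f ` M)"
    and inj: "inj_on f (carrier_mat nr nc)"
    and expanding: "V \<subseteq> f ` V"
  shows "f ` V = V"
proof -
  define M where "M k = ((`) f ^^ k) V" for k
  have M0: "M 0 = V" and MS: "M (Suc k) = f ` M k" for k unfolding M_def by auto
  have sub: "mat_submodule nr nc (M k)" for k
    by (induction k) (auto simp: M0 MS V f)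
  have "M k \<subseteq> M (Suc k)" for k
    by (induction k) (use expanding in \<open>auto simp: M0 MS\<close>)
  then obtain N where N: "\<forall>k\<ge>N. M k = M N"
    using noetherian_mat[OF noeth, of nr nc M] sub by blast
  have "M (Suc N) = M N" using N le_Suc_eq by blast
  then have "M (Suc 0) = M 0"
  proof (induction N)
    case (Suc N)
    have "f ` M (Suc N) = f ` M N" using Suc.prems by (simp add: MS)
    then have "M (Suc N) = M N"
      using inj_on_image_eq_iff[OF inj, of "M (Suc N)" "M N"] sub[of "Suc N"] sub[of N]
      by (simp add: mat_submodule_def)
    then show ?case by (rule Suc.IH)
  qed
  then show ?thesis by (simp add: M0 MS)
qed

lemma mat_submodule_mult_right:
  fixes M :: "'a :: {ring, monoid_mult} mat set"
  assumes M: "mat_submodule nr n M" and B: "B \<in> carrier_mat n nc"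
  shows "mat_submodule nr nc ((\<lambda>X. X * B) ` M)"
proof -
  have c: "X \<in> carrier_mat nr n" if "X \<in> M" for X
    using M that unfolding mat_submodule_def by blast
  have 0: "0\<^sub>m nr nc \<in> (\<lambda>X. X * B) ` M"
    using M B by (intro image_eqI[of _ _ "0\<^sub>m nr n"]) (auto simp: mat_submodule_def)
  have d: "X * B - Y * B \<in> (\<lambda>X. X * B) ` M" if "X \<in> M" "Y \<in> M" for X Y
    using M that minus_mult_distrib_mat[OF c[OF that(1)] c[OF that(2)] B]
    by (intro image_eqI[of _ _ "X - Y"]) (auto simp: mat_submodule_def)
  have s: "r \<cdot>\<^sub>m (X * B) \<in> (\<lambda>X. X * B) ` M" if "X \<in> M" for r X
  proof (rule image_eqI[of _ _ "r \<cdot>\<^sub>m X"])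
    show "r \<cdot>\<^sub>m (X * B) = (r \<cdot>\<^sub>m X) * B"
      using c[OF that] B by (intro eq_matI) (auto simp: scalar_prod_def sum_distrib_left mult.assoc)
    show "r \<cdot>\<^sub>m X \<in> M" using M that by (simp add: mat_submodule_def)
  qed
  have "(\<lambda>X. X * B) ` M \<subseteq> carrier_mat nr nc" using mult_carrier_mat[OF c B] by blast
  then show ?thesis unfolding mat_submodule_def using 0 d s by blast
qed

text \<open>
  The identity laws are computed entrywise, which covers the zero ring; the usual laws for matrices
  over a unital semiring come with the assumption \<open>0 \<noteq> 1\<close>.
\<close>

lemma monoid_matrix_ring: "monoid (matrix_ring TYPE('a :: {ring, monoid_mult}) n)"
proof -
  have "1\<^sub>m n * X = X" if X: "X \<in> carrier_mat n n" for X :: "'a mat"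
  proof (rule eq_matI)
    fix i j assume ij: "i < dim_row X" "j < dim_col X"
    have "(1\<^sub>m n * X) $$ (i, j) = (\<Sum>k\<in>{0..<n}. if i = k then X $$ (k, j) else 0)"
      using X ij by (simp add: scalar_prod_def if_distrib[of "\<lambda>x. x * _"] cong: if_cong)
    also have "\<dots> = X $$ (i, j)" using X ij by simp
    finally show "(1\<^sub>m n * X) $$ (i, j) = X $$ (i, j)" .
  qed (use X in auto)
  moreover have "X * 1\<^sub>m n = X" if X: "X \<in> carrier_mat n n" for X :: "'a mat"
  proof (rule eq_matI)
    fix i j assume ij: "i < dim_row X" "j < dim_col X"
    have "(X * 1\<^sub>m n) $$ (i, j) = (\<Sum>k\<in>{0..<n}. if k = j then X $$ (i, k) else 0)"
      using X ij by (simp add: scalar_prod_def if_distrib[of "\<lambda>x. _ * x"] cong: if_cong)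
    also have "\<dots> = X $$ (i, j)" using X ij by simp
    finally show "(X * 1\<^sub>m n) $$ (i, j) = X $$ (i, j)" .
  qed (use X in auto)
  ultimately show ?thesis
    by unfold_locales (auto simp: matrix_ring_def assoc_mult_mat)
qed

lemma mat_submodule_structural_matrices: "mat_submodule n n (structural_matrices n \<theta>)"
  unfolding mat_submodule_def structural_matrices_def by (auto simp: less_eq_Suc_le)

lemma one_mat_structural:
  assumes "refl_on {1..n} \<theta>"
  shows "(1\<^sub>m n :: 'a :: {ring, monoid_mult} mat) \<in> structural_matrices n \<theta>"
proof -
  have "1\<^sub>m n $$ (i - 1, j - 1) = (0 :: 'a)"
    if "i \<in> {1..n}" "j \<in> {1..n}" "(i, j) \<notin> \<theta>" for i j
  proof -
    have "i \<noteq> j" using that refl_onD[OF assms, of i] by blast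
    then have "i - 1 < n" "j - 1 < n" "i - 1 \<noteq> j - 1" using that(1,2) by auto
    then show ?thesis by simp
  qed
  then show ?thesis unfolding structural_matrices_def by simp
qed

lemma mult_structural:
  assumes tr: "trans \<theta>"
    and X: "X \<in> structural_matrices n \<theta>" and Y: "Y \<in> structural_matrices n \<theta>"
  shows "X * Y \<in> structural_matrices n \<theta>"
proof -
  have c: "X \<in> carrier_mat n n" "Y \<in> carrier_mat n n"
    using X Y unfolding structural_matrices_def by auto
  have "(X * Y) $$ (i - 1, j - 1) = 0"
    if ij: "i \<in> {1..n}" "j \<in> {1..n}" "(i, j) \<notin> \<theta>" for i j
  proof -
    have "X $$ (i - 1, k) * Y $$ (k, j - 1) = 0" if k: "k < n" for k
    proof -
      have "(i, Suc k) \<notin> \<theta> \<or> (Suc k, j) \<notin> \<theta>" using tr ij(3) by (meson transD)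
      moreover have "Suc k \<in> {1..n}" using k by simp
      ultimately have "X $$ (i - 1, Suc k - 1) = 0 \<or> Y $$ (Suc k - 1, j - 1) = 0"
        using X Y ij unfolding structural_matrices_def by blast
      then show ?thesis by auto
    qed
    moreover have "i - 1 < n" "j - 1 < n" using ij by auto
    ultimately show ?thesis using c by (auto simp: scalar_prod_def intro!: sum.neutral)
  qed
  then show ?thesis using c unfolding structural_matrices_def by auto
qed

theorem theorem3p1:
  fixes n :: nat and \<theta> :: "(nat \<times> nat) set" and A :: "'a :: {ring, monoid_mult} mat"
  assumes "n \<ge> 1"
    and "\<theta> \<subseteq> {1..n} \<times> {1..n}"
    and "refl_on {1..n} \<theta>"
    and "trans \<theta>"
    and "left_noetherian TYPE('a)"
    and "A \<in> structural_matrices n \<theta>"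
    and "A \<in> Units (matrix_ring TYPE('a) n)"
  shows "inv\<^bsub>matrix_ring TYPE('a) n\<^esub> A \<in> structural_matrices n \<theta>"
proof -
  define S where "S = (structural_matrices n \<theta> :: 'a mat set)"
  define B where "B = inv\<^bsub>matrix_ring TYPE('a) n\<^esub> A"
  interpret monoid "matrix_ring TYPE('a) n" by (rule monoid_matrix_ring)
  have A: "A \<in> carrier_mat n n" using assms(6) unfolding structural_matrices_def by blast
  have B: "B \<in> carrier_mat n n"
    using Units_inv_closed[OF assms(7)] unfolding B_def by (simp add: matrix_ring_def)
  have AB: "A * B = 1\<^sub>m n" and BA: "B * A = 1\<^sub>m n"
    using Units_r_inv[OF assms(7)] Units_l_inv[OF assms(7)] unfolding B_def
    by (simp_all add: matrix_ring_def)
  have id: "X * 1\<^sub>m n = X" "1\<^sub>m n * X = X" if "X \<in> carrier_mat n n" for X :: "'a mat"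
    using r_one[of X] l_one[of X] that by (simp_all add: matrix_ring_def)
  have car: "X \<in> carrier_mat n n" if "X \<in> S" for X
    using that unfolding S_def structural_matrices_def by blast
  have "(\<lambda>X. X * B) ` S = S"
  proof (rule inj_expanding_imp_stable[OF assms(5)])
    show "mat_submodule n n S" unfolding S_def by (rule mat_submodule_structural_matrices)
    show "mat_submodule n n ((\<lambda>X. X * B) ` M)" if "mat_submodule n n M" for M
      using mat_submodule_mult_right[OF that B] .
    show "inj_on (\<lambda>X. X * B) (carrier_mat n n)"
    proof (rule inj_on_inverseI)
      fix X :: "'a mat" assume "X \<in> carrier_mat n n"
      then show "(X * B) * A = X" using assoc_mult_mat[OF _ B A] BA id by simp
    qed
    show "S \<subseteq> (\<lambda>X. X * B) ` S"
    proof
      fix X assume X: "X \<in> S"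
      have "X * A \<in> S" using mult_structural[OF assms(4)] X assms(6) unfolding S_def by blast
      moreover have "X = (X * A) * B" using assoc_mult_mat[OF car[OF X] A B] AB id car[OF X] by simp
      ultimately show "X \<in> (\<lambda>X. X * B) ` S" by blast
    qed
  qed
  moreover have "1\<^sub>m n * B \<in> (\<lambda>X. X * B) ` S"
    using one_mat_structural[OF assms(3)] unfolding S_def by blast
  ultimately show ?thesis using id[OF B] unfolding S_def B_def by simp
qed

end
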